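(* Let $\Delta=\{1,\dots,d\}$ and let $(G,L)$ be a decomposable stratified graph on $\Delta$. For each positive definite $\Sigma\in\mathbb{R}^{d\times d}$ let $g_\Sigma$ be the (zero-mean) density on $\mathbb{R}^d$ of the decomposable stratified Gaussian graphical model with stratified graph $(G,L)$ and parameter $\Sigma$, as defined in the context. Then the distribution in this model belongs to the curved exponential family. That is, there exist an integer $k$ strictly larger than the dimension of the parameter $\Sigma$ and real-valued functions $\eta_1,\dots,\eta_k,\psi$ of $\Sigma$ and $T_1,\dots,T_k,h$ of $x$ such that, for all positive definite $\Sigma$ and all $x\in\mathbb{R}^d$, $$g_\Sigma(x)=\exp\Big(\sum_{i=1}^k\eta_i(\Sigma)T_i(x)-\psi(\Sigma)\Big)h(x).$$
   Context: **Graphs.** $G=(\Delta,E)$ is a finite undirected simple graph. A clique is a maximal set of pairwise adjacent nodes; $\mathcal{C}(G)$ is the set of cliques. $G$ is decomposable (chordal) if every cycle with four or more distinct nodes has a chord. For decomposable $G$, the set $\mathcal{S}(G)$ of separators consists of the intersections of neighbouring cliques in a junction tree of $G$. **Strata.** For $\{\delta,\gamma\}\in E$ let $L_{\{\delta,\gamma\}}$ be the set of nodes adjacent to both $\delta$ and $\gamma$. If $L_{\{\delta,\gamma\}}\neq\varnothing$, a stratum of the edge is a set $\mathcal{L}_{\{\delta,\gamma\}}\subseteq\mathbb{R}^{L_{\{\delta,\gamma\}}}$ that is a finite union of sets (open boxes) $\{x: a_\zeta<x_\zeta<b_\zeta \text{ for all }\zeta\in L_{\{\delta,\gamma\}}\}$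 with $a_\zeta,b_\zeta\in\mathbb{R}\cup\{\pm\infty\}$. It encodes the context-specific independence $X_\delta\perp X_\gamma\mid X_{L_{\{\delta,\gamma\}}}=x$ for $x\in\mathcal{L}_{\{\delta,\gamma\}}$. An edge with no stratum is regarded as having the empty stratum; an edge with a nonempty stratum is called stratified. A stratified graph (SG) is a pair $(G,L)$, where $L$ is the collection of all strata of edges of $G$. **Decomposable SG.** $(G,L)$ is decomposable if $G$ is decomposable, no stratified edge has both endpoints in a common separator $S\in\mathcal{S}(G)$, and for every clique $C\in\mathcal{C}(G)$ either $C$ contains no stratified edge or all stratified edges within $C$ have a node in common. (Then for a stratified edge $\{\delta,\gamma\}$ the set $L_{\{\delta,\gamma\}}\cup\{\delta,\gamma\}$ is the unique clique containing the edge.) **Graph attached to a point.** Let $(G,L)$ be a decomposable SG and $C$ a clique containing stratified edges. - *Discretization.* For each $\zeta\in C$, partition the real line into intervals by cutting immediately after every finite $\omega$ that occurs as a lower limit $a_\zeta$, and immediately before every finite $\omega$ that occurs as an upper limit $b_\zeta$, in a condition $a_\zeta<x_\zeta<b_\zeta$ used to define a stratum of an edge within $C$. (If $\omega$ occurs as both, $\{\omega\}$ is an interval of the partition.) Products of these intervals are called cells; each stratum in $C$ is a union of cells. - *Merging.* Let $v\in C$ be a node common to all stratified edges within $C$. Consider the cells of the coordinates in $C\setminus\{v\}$ (the "parent outcomes"). For each stratified edge $\{\delta,v\}$ within $C$, merge any two parent outcomes that agree in all coordinates of $L_{\{\delta,v\}}=C\setminus\{\delta,v\}$ when these common coordinates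 form a cell contained in $\mathcal{L}_{\{\delta,v\}}$. Taking the transitive closure of these mergings gives a partition of the parent outcomes into blocks. - *Deletion.* For a point $x\in\mathbb{R}^\Delta$, an edge $\{\delta,v\}$ within $C$ is deleted at $x$ if the block containing the parent outcome of $x$ contains some parent outcome whose $L_{\{\delta,v\}}$-coordinates lie in $\mathcal{L}_{\{\delta,v\}}$. Let $G(x)$ be the graph on $\Delta$ obtained from $G$ by deleting, over all cliques, all edges deleted at $x$. As $x$ varies, $G(x)$ takes finitely many values. This gives a finite partition of $\mathbb{R}^d$ into blocks, described by conditions $c^{(1)},\dots,c^{(\rho)}$, such that $G(x)$ equals a fixed graph $G^{(r)}$ on the block $c^{(r)}$. **Density of the model.** The mean is taken to be zero. For positive definite $\Sigma$ and each $r$, let $\Sigma^{(r)}$ be the covariance matrix obtained from $\Sigma$ by iterative proportional fitting to $G^{(r)}$. That is, $\Sigma^{(r)}$ is the unique positive definite matrix with $\Sigma^{(r)}_{ii}=\Sigma_{ii}$ for all $i$, $\Sigma^{(r)}_{ij}=\Sigma_{ij}$ for all edges $\{i,j\}$ of $G^{(r)}$, and $K^{(r)}=(\Sigma^{(r)})^{-1}$ satisfying $K^{(r)}_{ij}=0$ for all $i\ne j$ with $\{i,j\}$ not an edge of $G^{(r)}$. The density is $$g_\Sigma(x)=\frac1Z\sum_{r=1}^{\rho}(2\pi)^{-d/2}|K^{(r)}|^{1/2}e^{-\frac12x^TK^{(r)}x}\,I_{c^{(r)}}(x),$$ where $I_{c^{(r)}}$ is the indicator function of the block $c^{(r)}$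 and $Z=Z(\Sigma)>0$ is the normalizing constant making $g_\Sigma$ integrate to one. **Convention.** A family of densities $f_\theta$ that can be written as $f_\theta(x)=e^{\sum_{i=1}^k\eta_i(\theta)T_i(x)-\psi(\theta)}h(x)$ is called an exponential family when $k$ equals the dimension of $\theta$, and a curved exponential family when $k$ exceeds the dimension of $\theta$. Here $\theta=\Sigma$ ranges over the positive definite $d\times d$ matrices, of dimension $d(d+1)/2$. *)

theory Defs
  imports "HOL-Analysis.Analysis"
begin

section \<open>Undirected simple graphs\<close>

text \<open>Edges are two-element sets of nodes.\<close>

definition simple_ugraph :: "'a set \<Rightarrow> 'a set set \<Rightarrow> bool" where
  "simple_ugraph V E \<longleftrightarrow> finite V \<and> (\<forall>e\<in>E. e \<subseteq> V \<and> card e = 2)"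

definition upath :: "'a set set \<Rightarrow> 'a list \<Rightarrow> bool" where
  "upath E vs \<longleftrightarrow> vs \<noteq> [] \<and> distinct vs \<and>
     (\<forall>i. Suc i < length vs \<longrightarrow> {vs ! i, vs ! Suc i} \<in> E)"

definition ucycle :: "'a set set \<Rightarrow> 'a list \<Rightarrow> bool" where
  "ucycle E vs \<longleftrightarrow> 3 \<le> length vs \<and> distinct vs \<and>
     (\<forall>i<length vs. {vs ! i, vs ! (Suc i mod length vs)} \<in> E)"

definition uchord :: "'a set set \<Rightarrow> 'a list \<Rightarrow> nat \<Rightarrow> nat \<Rightarrow> bool" where
  "uchord E vs i j \<longleftrightarrow> i < length vs \<and> j < length vs \<and> i \<noteq> j \<and>
     j \<noteq> Suc i mod length vs \<and> i \<noteq> Suc j mod length vs \<and> {vs ! i, vs ! j} \<in> E"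

definition chordal :: "'a set set \<Rightarrow> bool" where
  "chordal E \<longleftrightarrow> (\<forall>vs. ucycle E vs \<and> 4 \<le> length vs \<longrightarrow> (\<exists>i j. uchord E vs i j))"

definition utree :: "'a set \<Rightarrow> 'a set set \<Rightarrow> bool" where
  "utree V T \<longleftrightarrow> simple_ugraph V T \<and>
     (\<forall>u\<in>V. \<forall>v\<in>V. \<exists>vs. upath T vs \<and> hd vs = u \<and> last vs = v) \<and>
     (\<nexists>vs. ucycle T vs)"

definition complete_in :: "'a set set \<Rightarrow> 'a set \<Rightarrow> bool" where
  "complete_in E C \<longleftrightarrow> (\<forall>a\<in>C. \<forall>b\<in>C. a \<noteq> b \<longrightarrow> {a, b} \<in> E)"

text \<open>The node set of a stratified graph is the whole finite type, so every \<open>C\<close> is a set of nodes.\<close>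

definition cliques :: "('n::finite) set set \<Rightarrow> 'n set set" where
  "cliques E = {C. complete_in E C \<and> (\<forall>D. complete_in E D \<and> C \<subseteq> D \<longrightarrow> D = C)}"

text \<open>A tree on the cliques with the running intersection property.\<close>

definition junction_tree :: "('n::finite) set set \<Rightarrow> 'n set set set \<Rightarrow> bool" where
  "junction_tree E T \<longleftrightarrow> utree (cliques E) T \<and>
     (\<forall>Cs. upath T Cs \<longrightarrow> (\<forall>D\<in>set Cs. hd Cs \<inter> last Cs \<subseteq> D))"

text \<open>All junction trees of a chordal graph yield the same set of separators.\<close>

definition separators :: "('n::finite) set set \<Rightarrow> 'n set set" where
  "separators E = {C \<inter> D | C D T. junction_tree E T \<and> {C, D} \<in> T}"


section \<open>Stratified graphs\<close>

definition common_nbrs :: "('n::finite) set set \<Rightarrow> 'n set \<Rightarrow> 'n set" where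
  "common_nbrs E e = {z. \<forall>a\<in>e. {z, a} \<in> E}"

text \<open>
  A box assigns to every coordinate a lower and an upper limit; for a box attached to an edge
  \<open>e\<close> only the coordinates in \<open>common_nbrs E e\<close> matter.  The collection \<open>L\<close> gives, for each edge,
  the finite set of boxes defining its stratum; the empty set stands for an edge without stratum.
\<close>

type_synonym 'n box = "'n \<Rightarrow> ereal \<times> ereal"

text \<open>The stratum as a subset of the space of real families indexed by \<open>common_nbrs E e\<close>
  (extensional functions).\<close>

definition stratum ::
  "('n::finite) set set \<Rightarrow> ('n set \<Rightarrow> 'n box set) \<Rightarrow> 'n set \<Rightarrow> ('n \<Rightarrow> real) set" where
  "stratum E L e = (\<Union>B\<in>L e. PiE (common_nbrs E e)
     (\<lambda>z. {t. fst (B z) < ereal t \<and> ereal t < snd (B z)}))"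

definition stratified_graph ::
  "('n::finite) set set \<Rightarrow> ('n set \<Rightarrow> 'n box set) \<Rightarrow> bool" where
  "stratified_graph E L \<longleftrightarrow> simple_ugraph UNIV E \<and>
     (\<forall>e. finite (L e) \<and> (L e \<noteq> {} \<longrightarrow> e \<in> E \<and> common_nbrs E e \<noteq> {}))"

definition stratified_edges ::
  "('n::finite) set set \<Rightarrow> ('n set \<Rightarrow> 'n box set) \<Rightarrow> 'n set set" where
  "stratified_edges E L = {e \<in> E. stratum E L e \<noteq> {}}"

definition stratified_edges_in ::
  "('n::finite) set set \<Rightarrow> ('n set \<Rightarrow> 'n box set) \<Rightarrow> 'n set \<Rightarrow> 'n set set" where
  "stratified_edges_in E L C = {e \<in> stratified_edges E L. e \<subseteq> C}"

definition decomposable_SG ::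
  "('n::finite) set set \<Rightarrow> ('n set \<Rightarrow> 'n box set) \<Rightarrow> bool" where
  "decomposable_SG E L \<longleftrightarrow> stratified_graph E L \<and> chordal E \<and>
     (\<forall>e\<in>stratified_edges E L. \<forall>S\<in>separators E. \<not> e \<subseteq> S) \<and>
     (\<forall>C\<in>cliques E. stratified_edges_in E L C = {} \<or>
        (\<exists>v. \<forall>e\<in>stratified_edges_in E L C. v \<in> e))"


section \<open>The graph attached to a point\<close>

definition lower_limits ::
  "('n::finite) set set \<Rightarrow> ('n set \<Rightarrow> 'n box set) \<Rightarrow> 'n set \<Rightarrow> 'n \<Rightarrow> real set" where
  "lower_limits E L C z = {w. \<exists>e\<in>E. e \<subseteq> C \<and> z \<in> common_nbrs E e \<and> (\<exists>B\<in>L e. fst (B z) = ereal w)}"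

definition upper_limits ::
  "('n::finite) set set \<Rightarrow> ('n set \<Rightarrow> 'n box set) \<Rightarrow> 'n set \<Rightarrow> 'n \<Rightarrow> real set" where
  "upper_limits E L C z = {w. \<exists>e\<in>E. e \<subseteq> C \<and> z \<in> common_nbrs E e \<and> (\<exists>B\<in>L e. snd (B z) = ereal w)}"

text \<open>Two reals lie in the same interval iff no cut (immediately after a lower limit or
  immediately before an upper limit) separates them.\<close>

definition same_interval ::
  "('n::finite) set set \<Rightarrow> ('n set \<Rightarrow> 'n box set) \<Rightarrow> 'n set \<Rightarrow> 'n \<Rightarrow> (real \<times> real) set" where
  "same_interval E L C z = {(s, t).
     (\<forall>w\<in>lower_limits E L C z. s \<le> w \<longleftrightarrow> t \<le> w) \<and>
     (\<forall>w\<in>upper_limits E L C z. s < w \<longleftrightarrow> t < w)}"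

definition intervals ::
  "('n::finite) set set \<Rightarrow> ('n set \<Rightarrow> 'n box set) \<Rightarrow> 'n set \<Rightarrow> 'n \<Rightarrow> real set set" where
  "intervals E L C z = UNIV // same_interval E L C z"

text \<open>A cell over a set \<open>A\<close> of coordinates is represented by the family \<open>p\<close> of its intervals; as a
  set of real families it is \<open>PiE A p\<close>.\<close>

definition parent_outcomes ::
  "('n::finite) set set \<Rightarrow> ('n set \<Rightarrow> 'n box set) \<Rightarrow> 'n set \<Rightarrow> 'n \<Rightarrow> ('n \<Rightarrow> real set) set" where
  "parent_outcomes E L C v = PiE (C - {v}) (intervals E L C)"

definition outcome_of ::
  "('n::finite) set set \<Rightarrow> ('n set \<Rightarrow> 'n box set) \<Rightarrow> 'n set \<Rightarrow> 'n \<Rightarrow> real^'n \<Rightarrow> ('n \<Rightarrow> real set)" where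
  "outcome_of E L C v x = (\<lambda>z\<in>C - {v}. same_interval E L C z `` {x $ z})"

definition lies_in_stratum ::
  "('n::finite) set set \<Rightarrow> ('n set \<Rightarrow> 'n box set) \<Rightarrow> ('n \<Rightarrow> real set) \<Rightarrow> 'n set \<Rightarrow> bool" where
  "lies_in_stratum E L p e \<longleftrightarrow> PiE (common_nbrs E e) p \<subseteq> stratum E L e"

definition merge_step ::
  "('n::finite) set set \<Rightarrow> ('n set \<Rightarrow> 'n box set) \<Rightarrow> 'n set \<Rightarrow> 'n
     \<Rightarrow> (('n \<Rightarrow> real set) \<times> ('n \<Rightarrow> real set)) set" where
  "merge_step E L C v = {(p, q). p \<in> parent_outcomes E L C v \<and> q \<in> parent_outcomes E L C v \<and>
     (\<exists>\<delta>. {\<delta>, v} \<in> stratified_edges_in E L C \<and>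
        (\<forall>z\<in>common_nbrs E {\<delta>, v}. p z = q z) \<and> lies_in_stratum E L p {\<delta>, v})}"

text \<open>Only stratified edges need to be considered: nothing lies in an empty stratum.  In a
  decomposable stratified graph a stratified edge \<open>{\<delta>, v}\<close> within the clique \<open>C\<close> satisfies
  \<open>common_nbrs E {\<delta>, v} = C - {\<delta>, v}\<close>, so that parent outcomes have all coordinates used in
  \<open>lies_in_stratum\<close>.  The node \<open>v\<close> common to all stratified edges within \<open>C\<close> is ambiguous only if
  there is just one such edge, and then both choices delete it at the same points.\<close>

definition deleted_edges ::
  "('n::finite) set set \<Rightarrow> ('n set \<Rightarrow> 'n box set) \<Rightarrow> 'n set \<Rightarrow> real^'n \<Rightarrow> 'n set set" where
  "deleted_edges E L C x = {{\<delta>, v} | \<delta> v.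
     (\<forall>e\<in>stratified_edges_in E L C. v \<in> e) \<and> {\<delta>, v} \<in> stratified_edges_in E L C \<and>
     (\<exists>q. (outcome_of E L C v x, q) \<in> (merge_step E L C v)\<^sup>* \<and> lies_in_stratum E L q {\<delta>, v})}"

definition graph_at ::
  "('n::finite) set set \<Rightarrow> ('n set \<Rightarrow> 'n box set) \<Rightarrow> real^'n \<Rightarrow> 'n set set" where
  "graph_at E L x = E - (\<Union>C\<in>cliques E. deleted_edges E L C x)"


section \<open>The density\<close>

definition pos_def :: "real^'n^'n \<Rightarrow> bool" where
  "pos_def A \<longleftrightarrow> transpose A = A \<and> (\<forall>x. x \<noteq> 0 \<longrightarrow> 0 < x \<bullet> (A *v x))"

text \<open>The limit of iterative proportional fitting of \<open>S\<close> to the graph \<open>H\<close>, through its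
  characterisation.\<close>

definition ipf :: "real^'n^'n \<Rightarrow> ('n::finite) set set \<Rightarrow> real^'n^'n" where
  "ipf S H = (THE R. pos_def R \<and> (\<forall>i. R $ i $ i = S $ i $ i) \<and>
     (\<forall>i j. {i, j} \<in> H \<longrightarrow> R $ i $ j = S $ i $ j) \<and>
     (\<forall>i j. i \<noteq> j \<and> {i, j} \<notin> H \<longrightarrow> matrix_inv R $ i $ j = 0))"

definition gauss_density :: "real^'n^'n \<Rightarrow> real^'n \<Rightarrow> real" where
  "gauss_density K x = (2 * pi) powr (- (real CARD('n) / 2)) * sqrt (det K)
     * exp (- (1/2) * (x \<bullet> (K *v x)))"

text \<open>The blocks of the partition are the level sets of \<open>graph_at E L\<close>, indexed by its finitely
  many values.\<close>

definition sg_unnormalized ::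
  "('n::finite) set set \<Rightarrow> ('n set \<Rightarrow> 'n box set) \<Rightarrow> real^'n^'n \<Rightarrow> real^'n \<Rightarrow> real" where
  "sg_unnormalized E L S x = (\<Sum>H\<in>range (graph_at E L).
     gauss_density (matrix_inv (ipf S H)) x * indicator {y. graph_at E L y = H} x)"

definition sg_Z ::
  "('n::finite) set set \<Rightarrow> ('n set \<Rightarrow> 'n box set) \<Rightarrow> real^'n^'n \<Rightarrow> real" where
  "sg_Z E L S = (LINT x|lborel. sg_unnormalized E L S x)"

definition sg_density ::
  "('n::finite) set set \<Rightarrow> ('n set \<Rightarrow> 'n box set) \<Rightarrow> real^'n^'n \<Rightarrow> real^'n \<Rightarrow> real" where
  "sg_density E L S x = 1 / sg_Z E L S * sg_unnormalized E L S x"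


section \<open>Curved exponential families\<close>

definition prob_density :: "('x::euclidean_space \<Rightarrow> real) \<Rightarrow> bool" where
  "prob_density f \<longleftrightarrow> (\<forall>x. 0 \<le> f x) \<and> has_bochner_integral lborel f 1"

text \<open>\<open>m\<close> is the dimension of the parameter space \<open>\<Theta>\<close>.\<close>

definition curved_exponential_family ::
  "nat \<Rightarrow> 'p set \<Rightarrow> ('p \<Rightarrow> 'x::euclidean_space \<Rightarrow> real) \<Rightarrow> bool" where
  "curved_exponential_family m \<Theta> f \<longleftrightarrow>
     (\<forall>\<theta>\<in>\<Theta>. prob_density (f \<theta>)) \<and>
     (\<exists>k>m. \<exists>(\<eta> :: nat \<Rightarrow> 'p \<Rightarrow> real) (\<psi> :: 'p \<Rightarrow> real) (T :: nat \<Rightarrow> 'x \<Rightarrow> real) (h :: 'x \<Rightarrow> real).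
        \<forall>\<theta>\<in>\<Theta>. \<forall>x. f \<theta> x = exp ((\<Sum>i=1..k. \<eta> i \<theta> * T i x) - \<psi> \<theta>) * h x)"

end

theory Submission
  imports Defs "HOL-Probability.Distributions"
begin

text \<open>
  On the block where the attached graph is \<open>H\<close>, the density is a constant times the Gaussian density
  with concentration matrix \<open>K = matrix_inv (ipf S H)\<close>, and the logarithm of that Gaussian density
  is linear in the products \<open>x $ a * x $ b\<close> with coefficients \<open>- K $ a $ b / 2\<close>, plus \<open>ln (sqrt (det K))\<close>
  and a constant.  The coefficients depend on the block; this is repaired by multiplying every
  statistic with the indicator of its block.  So the indicators of the blocks and the products of
  an indicator with a \<open>x $ a * x $ b\<close> are sufficient statistics.  With \<open>\<rho> \<ge> 1\<close> blocks and
  \<open>n\<close> nodes there are \<open>\<rho> * (n\<^sup>2 + 1)\<close> of them, more than the dimension \<open>n * (n + 1) / 2\<close> of \<open>S\<close>,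
  and the normalising constant enters through \<open>\<psi>\<close>.

  For this computation to make sense, three analytic facts are needed.

  First, \<open>ipf S H\<close> has to be a positive definite matrix (\<open>pos_def_ipf\<close>), that is, the problem
  characterising it has exactly one solution, for an arbitrary graph \<open>H\<close>.
  Existence: the positive semidefinite matrices that agree with \<open>S\<close> on the diagonal and on the edges
  of \<open>H\<close> form a compact set, and a maximiser of the determinant on it is a solution, since the
  derivative of the determinant in the direction of a missing edge is a multiple of the entry of
  the inverse at that edge.  Uniqueness: if \<open>D\<close> is the difference of two solutions with inverses
  \<open>J\<close> and \<open>K\<close>, then \<open>J\<close> and \<open>K\<close> both have trace product zero with \<open>D\<close>, because their supports
  are disjoint from that of \<open>D\<close>; hence \<open>J - K = J D K\<close> has so too, and \<open>tr (J D K D) = 0\<close> forces \<open>D = 0\<close>.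

  Second, the blocks have to be Borel sets (\<open>borel_graph_at_level\<close>).  They are finite unions of
  intersections of half-spaces bounded by the finitely many cuts, as the attached graph at a point
  depends only on the position of the point relative to the cuts.

  Third, the normalising constant has to be positive and finite.  A Gaussian density is dominated
  by \<open>exp (- c * (norm x)\<^sup>2 / 2)\<close>, which is integrable as a product of one-dimensional densities, and
  the unnormalised density is strictly positive everywhere.
\<close>

section \<open>Positive definite matrices\<close>

lemma symmetric_inner_commute:
  fixes A :: "real^'n^'n"
  assumes "transpose A = A"
  shows "x \<bullet> (A *v y) = (A *v x) \<bullet> y"
  by (metis assms dot_lmul_matrix vector_transpose_matrix)

lemma symmetric_iff: "transpose A = A \<longleftrightarrow> (\<forall>i j. A $ i $ j = A $ j $ i)"
  by (auto simp: transpose_def vec_eq_iff)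

lemma pos_def_nonneg:
  fixes A :: "real^'n^'n"
  assumes "pos_def A"
  shows "0 \<le> x \<bullet> (A *v x)"
  using assms by (cases "x = 0") (auto simp: pos_def_def intro: less_imp_le)

lemma pos_def_ker:
  fixes A :: "real^'n^'n"
  assumes "pos_def A" "A *v x = 0"
  shows "x = 0"
  using assms unfolding pos_def_def by (metis inner_zero_right less_irrefl)

lemma pos_def_invertible:
  fixes A :: "real^'n^'n"
  assumes "pos_def A"
  shows "invertible A"
  using assms pos_def_ker matrix_left_invertible_ker invertible_left_inverse by metis

lemma matrix_inv_cancel:
  fixes A :: "real^'n^'n"
  assumes "invertible A"
  shows "A ** matrix_inv A = mat 1" "matrix_inv A ** A = mat 1"
  using someI_ex[of "\<lambda>B. A ** B = mat 1 \<and> B ** A = mat 1"] assms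
  by (auto simp: invertible_def matrix_inv_def)

lemma matrix_inv_eqI:
  fixes A :: "real^'n^'n"
  assumes "B ** A = mat 1"
  shows "matrix_inv A = B"
  by (metis assms invertible_left_inverse matrix_inv_cancel(1) matrix_mul_assoc
      matrix_mul_lid matrix_mul_rid)

lemma pos_def_matrix_inv:
  fixes A :: "real^'n^'n"
  assumes "pos_def A"
  shows "pos_def (matrix_inv A)"
proof -
  let ?B = "matrix_inv A"
  have inv: "A ** ?B = mat 1" "?B ** A = mat 1"
    using matrix_inv_cancel pos_def_invertible assms by blast+
  have sym: "transpose A = A" using assms by (simp add: pos_def_def)
  have "transpose ?B ** A = mat 1"
    by (metis inv(1) matrix_transpose_mul sym transpose_mat)
  then have "transpose ?B = ?B" by (metis matrix_inv_eqI)
  moreover have "0 < x \<bullet> (?B *v x)" if "x \<noteq> 0" for x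
  proof -
    have x: "x = A *v (?B *v x)" by (simp add: matrix_vector_mul_assoc inv)
    then have "?B *v x \<noteq> 0" using that by force
    then have "0 < (?B *v x) \<bullet> (A *v (?B *v x))" using assms by (simp add: pos_def_def)
    then show ?thesis using x by (simp add: inner_commute)
  qed
  ultimately show ?thesis by (simp add: pos_def_def)
qed

text \<open>The columns of \<open>U\<close> are an orthonormal basis for the inner product \<open>x \<bullet> (R *v y)\<close>.  A maximal
  orthonormal set is independent; if it had fewer than \<open>n\<close> elements \<open>w\<close>, some nonzero vector would be
  orthogonal to all vectors \<open>R *v w\<close> and could be normalised and added.  The result takes the place of
  a square root of \<open>R\<close>: it gives \<open>matrix_inv R = U ** transpose U\<close>.\<close>

lemma pos_def_orthonormal_basis:
  fixes R :: "real^'n^'n"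
  assumes pd: "pos_def R"
  obtains U :: "real^'n^'n" where "transpose U ** R ** U = mat 1"
proof -
  define orth where "orth F \<longleftrightarrow> finite F \<and>
    (\<forall>u\<in>F. \<forall>w\<in>F. u \<bullet> (R *v w) = (if u = w then 1 else 0))" for F :: "(real^'n) set"
  have sym: "x \<bullet> (R *v y) = y \<bullet> (R *v x)" for x y
    using pd symmetric_inner_commute[of R] unfolding pos_def_def by (metis inner_commute)
  have ind: "independent F" if F: "orth F" for F
  proof (rule independent_if_scalars_zero)
    show "finite F" using F by (simp add: orth_def)
    fix c w assume 0: "(\<Sum>x\<in>F. c x *\<^sub>R x) = 0" and w: "w \<in> F"
    have "0 = (\<Sum>x\<in>F. c x *\<^sub>R x) \<bullet> (R *v w)" by (simp add: 0)
    also have "\<dots> = (\<Sum>x\<in>F. c x * (if x = w then 1 else 0))"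
      unfolding inner_sum_left inner_scaleR_left using F w
      by (intro sum.cong) (auto simp: orth_def)
    also have "\<dots> = (\<Sum>x\<in>F. if x = w then c x else 0)" by (intro sum.cong) auto
    also have "\<dots> = c w" using w F by (simp add: orth_def)
    finally show "c w = 0" by simp
  qed
  have bound: "card F \<le> CARD('n)" if "orth F" for F
    using independent_card_le[OF ind[OF that]] that by (simp add: orth_def)
  have "orth {}" by (simp add: orth_def)
  then obtain F where F: "orth F" and mx: "\<And>F'. orth F' \<Longrightarrow> card F' \<le> card F"
    using ex_has_greatest_nat[of orth "{}" card "Suc CARD('n)"] bound by (auto simp: less_Suc_eq_le)
  have fin: "finite F" using F by (simp add: orth_def)
  have "card F = CARD('n)"
  proof (rule ccontr)
    assume "card F \<noteq> CARD('n)"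
    with bound[OF F] have lt: "card F < CARD('n)" by simp
    let ?W = "(\<lambda>w. R *v w) ` F"
    have "dim ?W \<le> card ?W" using fin by (intro dim_le_card') auto
    also have "\<dots> \<le> card F" using fin by (rule card_image_le)
    finally have "dim ?W < DIM(real^'n)" using lt by simp
    then obtain x where x: "x \<noteq> 0" "\<And>y. y \<in> span ?W \<Longrightarrow> orthogonal x y"
      using orthogonal_to_subspace_exists by blast
    define y where "y = (1 / sqrt (x \<bullet> (R *v x))) *\<^sub>R x"
    have pos: "0 < x \<bullet> (R *v x)" using pd x by (simp add: pos_def_def)
    have y1: "y \<bullet> (R *v y) = 1"
      using pos by (simp add: y_def matrix_vector_mult_scaleR real_sqrt_mult_self abs_of_pos)
    have y0: "y \<bullet> (R *v w) = 0" "w \<bullet> (R *v y) = 0" if "w \<in> F" for w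
    proof -
      have "orthogonal x (R *v w)" using that by (intro x(2) span_base) auto
      then show "y \<bullet> (R *v w) = 0" by (simp add: y_def orthogonal_def)
      then show "w \<bullet> (R *v y) = 0" by (simp add: sym)
    qed
    have "y \<notin> F" using y0 y1 by force
    moreover have "orth (insert y F)"
      using F y0 y1 \<open>y \<notin> F\<close> by (auto simp: orth_def)
    ultimately show False using mx[of "insert y F"] fin by simp
  qed
  then obtain f :: "'n \<Rightarrow> real^'n" where f: "bij_betw f UNIV F"
    using finite_same_card_bij[of "UNIV :: 'n set" F] fin by auto
  define U :: "real^'n^'n" where "U = (\<chi> i j. f j $ i)"
  have "(transpose U ** R ** U) $ i $ j = f i \<bullet> (R *v f j)" for i j
    by (simp add: matrix_matrix_mult_def transpose_def U_def inner_vec_def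
        matrix_vector_mult_def sum_distrib_left sum_distrib_right mult.assoc)
       (rule sum.swap)
  moreover have "f i \<bullet> (R *v f j) = (if i = j then 1 else 0)" for i j
    using F f by (auto simp: orth_def bij_betw_def inj_def)
  ultimately have "transpose U ** R ** U = mat 1"
    by (simp add: vec_eq_iff mat_def)
  then show ?thesis by (rule that)
qed

lemma det_pos_def:
  fixes R :: "real^'n^'n"
  assumes "pos_def R"
  shows "0 < det R"
proof -
  obtain U :: "real^'n^'n" where "transpose U ** R ** U = mat 1"
    using pos_def_orthonormal_basis[OF assms] .
  then have "det (transpose U ** R ** U) = 1" by simp
  then have eq: "(det U)\<^sup>2 * det R = 1" by (simp add: det_mul power2_eq_square mult_ac)
  show ?thesis
  proof (rule ccontr)
    assume "\<not> 0 < det R"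
    then have "(det U)\<^sup>2 * det R \<le> 0" by (simp add: mult_nonneg_nonpos)
    with eq show False by simp
  qed
qed

section \<open>The derivative of the determinant\<close>

text \<open>In the Leibniz expansion, the derivative of the summand of \<open>p\<close> removes one diagonal factor of the
  identity.  A permutation other than the identity moves at least two points, so that a vanishing
  factor is left; only the product of the diagonal entries contributes.\<close>

lemma has_derivative_det_at_identity:
  fixes X :: "real^'n^'n"
  shows "((\<lambda>t. det (mat 1 + t *\<^sub>R X)) has_real_derivative trace X) (at 0)"
proof -
  let ?I = "mat 1 :: real^'n^'n"
  let ?P = "{p. p permutes (UNIV :: 'n set)}"
  have "((\<lambda>t. \<Sum>p\<in>?P. of_int (sign p) * (\<Prod>i\<in>UNIV. ?I $ i $ p i + t * X $ i $ p i))
    has_real_derivative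
      (\<Sum>p\<in>?P. of_int (sign p) * (\<Sum>i\<in>UNIV. X $ i $ p i * (\<Prod>j\<in>UNIV - {i}. ?I $ j $ p j)))) (at 0)"
    (is "(_ has_real_derivative ?D) _")
    by (auto intro!: derivative_eq_intros sum.cong has_field_derivative_prod simp: mult.commute)
  moreover have "?D = trace X"
  proof -
    have zero: "(\<Prod>j\<in>UNIV - {i}. ?I $ j $ p j) = 0" if p: "p permutes UNIV" "p \<noteq> id" for p and i :: 'n
    proof -
      obtain a where a: "p a \<noteq> a" using p by (auto simp: fun_eq_iff)
      then have "p (p a) \<noteq> p a" using p(1) by (metis permutes_inj injD)
      then obtain j where "j \<noteq> i" "p j \<noteq> j" using a by metis
      then show ?thesis by (intro prod_zero) (auto simp: mat_def intro!: bexI[of _ j])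
    qed
    have "?D = (\<Sum>p\<in>{id}. of_int (sign p) * (\<Sum>i\<in>UNIV. X $ i $ p i * (\<Prod>j\<in>UNIV - {i}. ?I $ j $ p j)))"
      by (rule sum.mono_neutral_right) (auto simp: finite_permutations permutes_id zero)
    also have "\<dots> = trace X" by (simp add: trace_def mat_def)
    finally show ?thesis .
  qed
  ultimately show ?thesis by (simp add: det_def)
qed

lemma has_derivative_det:
  fixes R A :: "real^'n^'n"
  assumes "invertible R"
  shows "((\<lambda>t. det (R + t *\<^sub>R A)) has_real_derivative det R * trace (matrix_inv R ** A)) (at 0)"
proof -
  have "R ** (matrix_inv R ** A) = A"
    by (simp add: matrix_mul_assoc matrix_inv_cancel[OF assms])
  then have "R + t *\<^sub>R A = R ** (mat 1 + t *\<^sub>R (matrix_inv R ** A))" for t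
    by (simp add: matrix_add_ldistrib matrix_scalar_ac flip: scalar_matrix_assoc)
  then show ?thesis
    by (auto simp: det_mul intro!: derivative_eq_intros has_derivative_det_at_identity)
qed

section \<open>Semidefinite completions\<close>

text \<open>The constant is the minimum of the quadratic form on the unit sphere.  It serves twice: positive
  definiteness is an open condition, and Gaussian densities are dominated by rotationally symmetric
  ones.\<close>

lemma pos_def_lower_bound:
  fixes R :: "real^'n^'n"
  assumes "pos_def R"
  obtains c where "0 < c" "\<And>x. c * (norm x)\<^sup>2 \<le> x \<bullet> (R *v x)"
proof -
  have "continuous_on (sphere 0 1) (\<lambda>x. x \<bullet> (R *v x))"
    by (intro continuous_intros linear_continuous_on matrix_vector_mul_bounded_linear)
  moreover have "axis undefined 1 \<in> (sphere 0 1 :: (real^'n) set)" by simp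
  ultimately obtain u :: "real^'n" where u: "u \<in> sphere 0 1"
      "\<And>x. x \<in> sphere 0 1 \<Longrightarrow> u \<bullet> (R *v u) \<le> x \<bullet> (R *v x)"
    using continuous_attains_inf[of "sphere 0 1 :: (real^'n) set" "\<lambda>x. x \<bullet> (R *v x)"]
      compact_sphere by (metis empty_iff)
  show ?thesis
  proof
    have "u \<noteq> 0" using u(1) by auto
    then show "0 < u \<bullet> (R *v u)" using assms by (simp add: pos_def_def)
    fix x :: "real^'n"
    show "u \<bullet> (R *v u) * (norm x)\<^sup>2 \<le> x \<bullet> (R *v x)"
    proof (cases "x = 0")
      case False
      have "u \<bullet> (R *v u) \<le> (x /\<^sub>R norm x) \<bullet> (R *v (x /\<^sub>R norm x))"
        using False by (intro u(2)) simp
      also have "\<dots> = (x \<bullet> (R *v x)) / (norm x)\<^sup>2"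
        by (simp add: matrix_vector_mult_scaleR power2_eq_square divide_inverse mult_ac)
      finally show ?thesis using False by (simp add: field_simps)
    qed simp
  qed
qed

lemma pos_def_perturb:
  fixes R A :: "real^'n^'n"
  assumes "pos_def R" and A: "transpose A = A"
  obtains e where "0 < e" "\<And>t. \<bar>t\<bar> < e \<Longrightarrow> pos_def (R + t *\<^sub>R A)"
proof -
  obtain c where c: "0 < c" "\<And>x. c * (norm x)\<^sup>2 \<le> x \<bullet> (R *v x)"
    using pos_def_lower_bound[OF assms(1)] by blast
  obtain b where b: "0 < b" "\<And>x. norm (A *v x) \<le> norm x * b"
    using bounded_linear.pos_bounded[OF matrix_vector_mul_bounded_linear[of A]] by blast
  show ?thesis
  proof
    show "0 < c / b" using b c by simp
    fix t assume "\<bar>t\<bar> < c / b"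
    then have t: "\<bar>t\<bar> * b < c" using b by (simp add: field_simps)
    have "transpose (R + t *\<^sub>R A) = R + t *\<^sub>R A"
      using assms by (simp add: pos_def_def symmetric_iff)
    moreover have "0 < x \<bullet> ((R + t *\<^sub>R A) *v x)" if "x \<noteq> 0" for x
    proof -
      have "\<bar>x \<bullet> (A *v x)\<bar> \<le> norm x * (norm x * b)"
        using Cauchy_Schwarz_ineq2[of x "A *v x"] b(2)[of x]
        by (meson mult_left_mono norm_ge_zero order_trans)
      then have "\<bar>t * (x \<bullet> (A *v x))\<bar> \<le> \<bar>t\<bar> * (norm x * (norm x * b))"
        by (simp add: abs_mult mult_left_mono)
      also have "\<dots> = (\<bar>t\<bar> * b) * (norm x)\<^sup>2" by (simp add: power2_eq_square mult_ac)
      also have "\<dots> < c * (norm x)\<^sup>2" using t that by (intro mult_strict_right_mono) auto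
      also have "\<dots> \<le> x \<bullet> (R *v x)" by (rule c)
      finally have "0 < x \<bullet> (R *v x) + t * (x \<bullet> (A *v x))" by linarith
      moreover have "(R + t *\<^sub>R A) *v x = R *v x + t *\<^sub>R (A *v x)"
        by (simp add: matrix_vector_mult_add_rdistrib scaleR_matrix_vector_assoc)
      ultimately show ?thesis by (simp add: inner_add_right)
    qed
    ultimately show "pos_def (R + t *\<^sub>R A)" by (simp add: pos_def_def)
  qed
qed

text \<open>For \<open>y = R *v x\<close> the quadratic form at \<open>x + t *\<^sub>R y\<close> is \<open>2 * t * (y \<bullet> y) + t\<^sup>2 * (y \<bullet> (R *v y))\<close>.
  It would be negative for a suitable negative \<open>t\<close> unless \<open>y = 0\<close>.\<close>

lemma pos_semidef_ker:
  fixes R :: "real^'n^'n"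
  assumes sym: "transpose R = R" and psd: "\<And>x. 0 \<le> x \<bullet> (R *v x)" and x: "x \<bullet> (R *v x) = 0"
  shows "R *v x = 0"
proof -
  let ?y = "R *v x"
  define a b where "a = ?y \<bullet> ?y" and "b = ?y \<bullet> (R *v ?y)"
  have "0 \<le> 2 * t * a + t\<^sup>2 * b" for t
  proof -
    have "x \<bullet> (R *v ?y) = a" by (simp add: symmetric_inner_commute[OF sym] a_def)
    then have "(x + t *\<^sub>R ?y) \<bullet> (R *v (x + t *\<^sub>R ?y)) = 2 * t * a + t\<^sup>2 * b"
      using x by (simp add: matrix_vector_right_distrib matrix_vector_mult_scaleR inner_simps
          a_def b_def power2_eq_square algebra_simps)
    then show ?thesis using psd by metis
  qed
  \<comment> \<open>Adding one to \<open>b\<close> makes the denominator nonzero and still keeps the value negative if \<open>a \<noteq> 0\<close>.\<close>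
  from this[of "- a / (b + 1)"] have "0 \<le> 2 * (- a / (b + 1)) * a + (- a / (b + 1))\<^sup>2 * b" .
  moreover have b: "0 \<le> b" using psd by (simp add: b_def)
  moreover have "2 * (- a / (b + 1)) * a + (- a / (b + 1))\<^sup>2 * b = - (a\<^sup>2 * (b + 2)) / (b + 1)\<^sup>2"
    using b by (simp add: divide_simps power2_eq_square) (simp add: algebra_simps)
  ultimately have "0 \<le> - (a\<^sup>2 * (b + 2)) / (b + 1)\<^sup>2" by metis
  then have "a\<^sup>2 * (b + 2) \<le> 0"
    using b by (simp add: divide_le_0_iff)
  then have "a = 0" using b by (simp add: mult_le_0_iff)
  then show ?thesis by (simp add: a_def)
qed

text \<open>Test the form on the sum and the difference of two unit vectors.  As completions share the
  diagonal of \<open>S\<close>, this makes the set of completions bounded.\<close>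

lemma pos_semidef_entry_bound:
  fixes R :: "real^'n^'n"
  assumes sym: "transpose R = R" and psd: "\<And>x. 0 \<le> x \<bullet> (R *v x)"
  shows "2 * \<bar>R $ i $ j\<bar> \<le> R $ i $ i + R $ j $ j"
proof -
  have e: "axis k 1 \<bullet> (R *v axis l 1) = R $ k $ l" for k l
    by (simp add: inner_axis' matrix_vector_mult_basis column_def)
  have "R $ j $ i = R $ i $ j" using sym by (simp add: symmetric_iff)
  then show ?thesis
    using psd[of "axis i 1 + axis j 1"] psd[of "axis i 1 - axis j 1"]
    by (simp add: matrix_vector_right_distrib matrix_vector_mult_diff_distrib inner_simps e)
qed

lemma norm_matrix_le_sum:
  fixes R :: "real^'n^'m"
  shows "norm R \<le> (\<Sum>i\<in>UNIV. \<Sum>j\<in>UNIV. \<bar>R $ i $ j\<bar>)"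
  by (rule order_trans[OF order_trans[OF _ L2_set_le_sum]])
     (auto simp: norm_vec_def[of R] intro!: sum_mono norm_le_l1_cart)

text \<open>Semidefinite rather than definite matrices are admitted in order to obtain a closed, hence compact, set.\<close>

definition psd_completions :: "real^'n^'n \<Rightarrow> ('n::finite) set set \<Rightarrow> (real^'n^'n) set" where
  "psd_completions S H = {R. transpose R = R \<and> (\<forall>x. 0 \<le> x \<bullet> (R *v x)) \<and>
     (\<forall>i j. i = j \<or> {i, j} \<in> H \<longrightarrow> R $ i $ j = S $ i $ j)}"

lemma compact_psd_completions:
  fixes S :: "real^'n^'n"
  shows "compact (psd_completions S H)"
  unfolding compact_eq_bounded_closed
proof
  show "bounded (psd_completions S H)"
  proof (rule boundedI)
    fix R assume "R \<in> psd_completions S H"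
    then have sym: "transpose R = R" "\<And>x. 0 \<le> x \<bullet> (R *v x)" and d: "\<And>i. R $ i $ i = S $ i $ i"
      by (auto simp: psd_completions_def)
    have "\<bar>R $ i $ j\<bar> \<le> S $ i $ i + S $ j $ j" for i j
      using pos_semidef_entry_bound[OF sym, of i j] d by (simp add: abs_le_iff) linarith
    then show "norm R \<le> (\<Sum>i\<in>UNIV. \<Sum>j\<in>UNIV. S $ i $ i + S $ j $ j)"
      by (intro order_trans[OF norm_matrix_le_sum] sum_mono)
  qed
  have eq: "closed {R :: real^'n^'n. \<forall>i j. i = j \<or> {i, j} \<in> H \<longrightarrow> R $ i $ j = S $ i $ j}"
    by (intro closed_Collect_all closed_Collect_imp closed_Collect_eq continuous_intros) auto
  have "closed {R :: real^'n^'n. transpose R = R}"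
    unfolding symmetric_iff by (intro closed_Collect_all closed_Collect_eq continuous_intros)
  moreover have "closed {R :: real^'n^'n. \<forall>x. 0 \<le> x \<bullet> (R *v x)}"
    unfolding matrix_vector_mult_def inner_vec_def
    by (intro closed_Collect_all closed_Collect_le) (auto intro!: continuous_intros)
  ultimately show "closed (psd_completions S H)"
    unfolding psd_completions_def by (intro closed_Collect_conj eq)
qed

text \<open>The solution is a maximiser \<open>R\<close> of the determinant among the semidefinite completions.  Its
  determinant is at least that of \<open>S\<close>, hence positive, so that \<open>R\<close> is definite and can be moved in
  both directions along the symmetric matrix \<open>A\<close> with two unit entries at a missing edge.  The
  derivative of the determinant then vanishes, and it is \<open>det R\<close> times twice the entry of
  \<open>matrix_inv R\<close> at that edge.\<close>

lemma pos_def_completion_exists: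
  fixes S :: "real^'n^'n"
  assumes S: "pos_def S"
  obtains R where "pos_def R" "\<And>i. R $ i $ i = S $ i $ i"
    "\<And>i j. {i, j} \<in> H \<Longrightarrow> R $ i $ j = S $ i $ j"
    "\<And>i j. i \<noteq> j \<Longrightarrow> {i, j} \<notin> H \<Longrightarrow> matrix_inv R $ i $ j = 0"
proof -
  have S_in: "S \<in> psd_completions S H"
    using S pos_def_nonneg[OF S] by (simp add: psd_completions_def pos_def_def)
  have "continuous_on (psd_completions S H) (det :: real^'n^'n \<Rightarrow> real)"
    unfolding det_def by (intro continuous_intros)
  then obtain R where R: "R \<in> psd_completions S H"
      and mx: "\<And>Q. Q \<in> psd_completions S H \<Longrightarrow> det Q \<le> det R"
    using continuous_attains_sup[OF compact_psd_completions, of S H det] S_in by blast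
  have sym: "transpose R = R" and psd: "\<And>x. 0 \<le> x \<bullet> (R *v x)"
    and agree: "\<And>i j. i = j \<or> {i, j} \<in> H \<Longrightarrow> R $ i $ j = S $ i $ j"
    using R by (auto simp: psd_completions_def)
  have det: "0 < det R" using mx[OF S_in] det_pos_def[OF S] by linarith
  then have inv: "invertible R" by (simp add: invertible_det_nz)
  have "0 < x \<bullet> (R *v x)" if "x \<noteq> 0" for x
  proof -
    have "R *v x \<noteq> 0" using inv that
      by (metis invertible_left_inverse matrix_left_invertible_ker)
    then have "x \<bullet> (R *v x) \<noteq> 0" using pos_semidef_ker[OF sym psd] by blast
    then show ?thesis using psd[of x] by simp
  qed
  then have pd: "pos_def R" using sym by (simp add: pos_def_def)
  have "matrix_inv R $ i $ j = 0" if "i \<noteq> j" "{i, j} \<notin> H" for i j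
  proof -
    define A :: "real^'n^'n" where
      "A = (\<chi> k l. of_bool (k = i) * of_bool (l = j) + of_bool (k = j) * of_bool (l = i))"
    have A: "transpose A = A" by (auto simp: symmetric_iff A_def)
    obtain e where e: "0 < e" "\<And>t. \<bar>t\<bar> < e \<Longrightarrow> pos_def (R + t *\<^sub>R A)"
      using pos_def_perturb[OF pd A] by blast
    have "R + t *\<^sub>R A \<in> psd_completions S H" if t: "\<bar>t\<bar> < e" for t
    proof -
      have "A $ k $ l = 0" if "k = l \<or> {k, l} \<in> H" for k l
        using that \<open>i \<noteq> j\<close> \<open>{i, j} \<notin> H\<close> by (auto simp: A_def insert_commute)
      moreover have "0 \<le> x \<bullet> ((R + t *\<^sub>R A) *v x)" for x
        by (rule pos_def_nonneg[OF e(2)[OF t]])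
      ultimately show ?thesis
        using e(2)[OF t] agree by (auto simp: psd_completions_def pos_def_def)
    qed
    then have "\<forall>t. \<bar>0 - t\<bar> < e \<longrightarrow> det (R + t *\<^sub>R A) \<le> det (R + 0 *\<^sub>R A)"
      using mx by auto
    then have "det R * trace (matrix_inv R ** A) = 0"
      using DERIV_local_max[OF has_derivative_det[OF inv] e(1)] by blast
    moreover have "matrix_inv R $ k $ l * A $ l $ k =
        (if l = j then if k = i then matrix_inv R $ i $ j else 0 else 0) +
        (if l = i then if k = j then matrix_inv R $ j $ i else 0 else 0)" for k l
      by (auto simp: A_def)
    then have "trace (matrix_inv R ** A) = matrix_inv R $ i $ j + matrix_inv R $ j $ i"
      by (simp add: trace_def matrix_matrix_mult_def sum.distrib)
    moreover have "matrix_inv R $ j $ i = matrix_inv R $ i $ j"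
      using pos_def_matrix_inv[OF pd] by (simp add: pos_def_def symmetric_iff)
    ultimately show ?thesis using det by simp
  qed
  with that[of R] pd agree show ?thesis by blast
qed

lemma matrix_diff_distrib:
  fixes A B C :: "real^'n^'n"
  shows "(A - B) ** C = A ** C - B ** C" "C ** (A - B) = C ** A - C ** B"
  by (simp_all add: matrix_matrix_mult_def vec_eq_iff algebra_simps sum_subtractf)

lemma trace_congruence:
  fixes K V :: "real^'n^'n"
  shows "trace (transpose V ** K ** V) = (\<Sum>i\<in>UNIV. column i V \<bullet> (K *v column i V))"
proof -
  have "(transpose V ** K ** V) $ i $ i = column i V \<bullet> (K *v column i V)" for i
    by (simp add: matrix_matrix_mult_def transpose_def column_def inner_vec_def
        matrix_vector_mult_def sum_distrib_left sum_distrib_right mult.assoc)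
       (rule sum.swap)
  then show ?thesis by (simp add: trace_def)
qed

text \<open>With \<open>J\<close> and \<open>K\<close> the inverses of \<open>Q\<close> and \<open>R\<close> and \<open>D = R - Q\<close>, the matrices \<open>J\<close> and \<open>K\<close> vanish
  wherever \<open>D\<close> does not, so \<open>tr (J D) = tr (K D) = 0\<close>.  Since \<open>J D K = J - K\<close>, also
  \<open>tr (J D K D) = 0\<close>.  Factoring \<open>K = U U\<^sup>T\<close> turns this trace into the sum of the values of the
  positive definite form \<open>J\<close> on the columns of \<open>D U\<close>, which are therefore zero.\<close>

lemma pos_def_completion_unique:
  fixes Q R :: "real^'n^'n"
  assumes "pos_def Q" "pos_def R"
    and diag: "\<And>i. Q $ i $ i = R $ i $ i"
    and edge: "\<And>i j. {i, j} \<in> H \<Longrightarrow> Q $ i $ j = R $ i $ j"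
    and Q0: "\<And>i j. i \<noteq> j \<Longrightarrow> {i, j} \<notin> H \<Longrightarrow> matrix_inv Q $ i $ j = 0"
    and R0: "\<And>i j. i \<noteq> j \<Longrightarrow> {i, j} \<notin> H \<Longrightarrow> matrix_inv R $ i $ j = 0"
  shows "Q = R"
proof -
  define D where "D = R - Q"
  let ?J = "matrix_inv Q" and ?K = "matrix_inv R"
  note Qinv = matrix_inv_cancel[OF pos_def_invertible[OF assms(1)]]
    and Rinv = matrix_inv_cancel[OF pos_def_invertible[OF assms(2)]]
  have D0: "D $ j $ i = 0" if "i = j \<or> {i, j} \<in> H" for i j
    using that diag edge[of j i] by (auto simp: D_def insert_commute)
  have "?J $ i $ j * D $ j $ i = 0 \<and> ?K $ i $ j * D $ j $ i = 0" for i j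
    using D0[of i j] Q0[of i j] R0[of i j] by auto
  then have "trace (?J ** D) = 0" "trace (?K ** D) = 0"
    unfolding trace_def matrix_matrix_mult_def by (auto intro!: sum.neutral)
  moreover have "?J ** D ** ?K = ?J - ?K"
    by (simp add: D_def matrix_diff_distrib matrix_mul_assoc[symmetric] Rinv)
       (simp add: matrix_mul_assoc Qinv)
  ultimately have 0: "trace (?J ** D ** ?K ** D) = 0"
    by (simp add: matrix_diff_distrib trace_sub)
  obtain U :: "real^'n^'n" where U: "transpose U ** R ** U = mat 1"
    using pos_def_orthonormal_basis[OF assms(2)] .
  then have U': "U ** (transpose U ** R) = mat 1"
    by (metis matrix_left_right_inverse)
  then have K: "?K = U ** transpose U"
    by (metis matrix_inv_eqI matrix_mul_assoc)
  have symD: "transpose D = D"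
    using assms(1,2) by (auto simp: pos_def_def symmetric_iff D_def)
  define V where "V = D ** U"
  have "trace (transpose V ** ?J ** V) = trace ((transpose U ** D) ** (?J ** D ** U))"
    by (simp add: V_def matrix_transpose_mul symD matrix_mul_assoc)
  also have "\<dots> = trace ((?J ** D ** U) ** (transpose U ** D))"
    by (rule trace_mul_sym)
  also have "\<dots> = trace (?J ** D ** ?K ** D)"
    by (simp add: K matrix_mul_assoc)
  finally have "(\<Sum>i\<in>UNIV. column i V \<bullet> (?J *v column i V)) = 0"
    using 0 by (simp add: trace_congruence)
  moreover have J: "0 < x \<bullet> (?J *v x)" if "x \<noteq> 0" for x
    using pos_def_matrix_inv[OF assms(1)] that by (simp add: pos_def_def)
  moreover have "0 \<le> x \<bullet> (?J *v x)" for x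
    by (rule pos_def_nonneg[OF pos_def_matrix_inv[OF assms(1)]])
  ultimately have "column i V \<bullet> (?J *v column i V) = 0" for i
    by (simp add: sum_nonneg_eq_0_iff)
  then have "column i V = 0" for i using J by (metis less_irrefl)
  then have "V = 0" by (simp add: vec_eq_iff column_def)
  have "D = V ** (transpose U ** R)"
    by (simp add: V_def matrix_mul_assoc[symmetric] U')
  then show ?thesis using \<open>V = 0\<close> by (simp add: D_def)
qed

lemma pos_def_ipf:
  fixes S :: "real^'n^'n"
  assumes "pos_def S"
  shows "pos_def (ipf S H)"
proof -
  let ?P = "\<lambda>R. pos_def R \<and> (\<forall>i. R $ i $ i = S $ i $ i) \<and>
     (\<forall>i j. {i, j} \<in> H \<longrightarrow> R $ i $ j = S $ i $ j) \<and>
     (\<forall>i j. i \<noteq> j \<and> {i, j} \<notin> H \<longrightarrow> matrix_inv R $ i $ j = 0)"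
  have "\<exists>R. ?P R"
    by (rule pos_def_completion_exists[OF assms, of H]) blast
  moreover have "Q = R" if "?P Q" "?P R" for Q R
    by (rule pos_def_completion_unique[of Q R H]) (use that in simp_all)
  ultimately have "\<exists>!R. ?P R" by (rule ex_ex1I)
  from theI'[OF this] show ?thesis unfolding ipf_def by (rule conjunct1)
qed

section \<open>Gaussian densities\<close>

lemma integrable_gauss_density:
  fixes K :: "real^'n^'n"
  assumes "pos_def K"
  shows "integrable lborel (gauss_density K)"
proof -
  obtain c where c: "0 < c" "\<And>x. c * (norm x)\<^sup>2 \<le> x \<bullet> (K *v x)"
    using pos_def_lower_bound[OF assms] by blast
  \<comment> \<open>The dominating function is a product of copies of \<open>g\<close>, a multiple of a normal density with variance \<open>1 / c\<close>.\<close>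
  define g where "g = (\<lambda>t. exp (- (c / 2) * t\<^sup>2) :: real)"
  have g: "g \<in> borel_measurable borel" by (simp add: g_def)
  have "g t = sqrt (2 * pi * (1 / sqrt c)\<^sup>2) * normal_density 0 (1 / sqrt c) t" for t
    using c(1) by (simp add: normal_density_def g_def power_divide mult.commute)
  then have "integrable lborel g"
    using integrable_normal_density[of "1 / sqrt c" 0] c(1)
    by (auto cong: Bochner_Integration.integrable_cong)
  then have g_fin: "(\<integral>\<^sup>+t. ennreal (g t) \<partial>lborel) < \<infinity>"
    by (simp add: integrable_iff_bounded g_def)
  have "(\<integral>\<^sup>+x. (\<Prod>b\<in>Basis. ennreal (g (x \<bullet> b))) \<partial>(lborel :: (real^'n) measure))
      = (\<Prod>b\<in>(Basis :: (real^'n) set). \<integral>\<^sup>+t. ennreal (g t) \<partial>lborel)"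
    by (subst nn_integral_lborel_prod) (use g in auto)
  then have fin: "(\<integral>\<^sup>+x. (\<Prod>b\<in>Basis. ennreal (g (x \<bullet> b))) \<partial>(lborel :: (real^'n) measure)) < \<infinity>"
    using g_fin by (simp add: power_less_top_ennreal)
  have prod: "(\<Prod>b\<in>Basis. ennreal (g (x \<bullet> b))) = ennreal (exp (- (c / 2) * (norm x)\<^sup>2))" for x :: "real^'n"
  proof -
    have "(norm x)\<^sup>2 = (\<Sum>b\<in>Basis. (x \<bullet> b)\<^sup>2)"
      unfolding power2_norm_eq_inner by (subst euclidean_inner) (simp add: power2_eq_square)
    then show ?thesis
      by (simp add: g_def prod_ennreal exp_sum[symmetric] sum_distrib_left sum_negf)
  qed
  have "continuous_on UNIV (\<lambda>x. x \<bullet> (K *v x))"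
    by (intro continuous_intros linear_continuous_on matrix_vector_mul_bounded_linear)
  then have "(\<lambda>x. x \<bullet> (K *v x)) \<in> borel_measurable borel"
    by (rule borel_measurable_continuous_onI)
  then have meas: "(\<lambda>x. exp (- (1/2) * (x \<bullet> (K *v x)))) \<in> borel_measurable lborel" by simp
  have "integrable lborel (\<lambda>x :: real^'n. exp (- (c / 2) * (norm x)\<^sup>2))"
    using fin by (simp add: integrable_iff_bounded prod)
  then have "integrable lborel (\<lambda>x. exp (- (1/2) * (x \<bullet> (K *v x))))"
    by (rule Bochner_Integration.integrable_bound[OF _ meas]) (use c(2) in \<open>auto simp: mult.commute\<close>)
  then show ?thesis unfolding gauss_density_def by (intro integrable_mult_right)
qed

lemma gauss_density_pos: "pos_def K \<Longrightarrow> 0 < gauss_density K x"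
  by (simp add: gauss_density_def det_pos_def)

text \<open>The quadratic form is written as one sum over pairs, as its products of coordinates become the
  sufficient statistics.\<close>

lemma gauss_density_exp:
  fixes K :: "real^'n^'n"
  assumes "pos_def K"
  shows "gauss_density K x = exp (ln (sqrt (det K))
    + (\<Sum>(a, b)\<in>UNIV. - (1/2) * K $ a $ b * (x $ a * x $ b)) - real CARD('n) / 2 * ln (2 * pi))"
proof -
  have "x \<bullet> (K *v x) = (\<Sum>(a, b)\<in>UNIV. K $ a $ b * (x $ a * x $ b))"
    by (simp add: inner_vec_def matrix_vector_mult_def sum_distrib_left sum.cartesian_product
        mult_ac flip: UNIV_Times_UNIV)
  then have quad: "(\<Sum>(a, b)\<in>UNIV. - (1/2) * K $ a $ b * (x $ a * x $ b)) = - (1/2) * (x \<bullet> (K *v x))"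
    by (simp add: sum_distrib_left case_prod_unfold)
  have "sqrt (det K) = exp (ln (sqrt (det K)))" using det_pos_def[OF assms] by simp
  moreover have "(2 * pi) powr (- (real CARD('n) / 2)) = exp (- (real CARD('n) / 2 * ln (2 * pi)))"
    by (simp add: powr_def)
  moreover have "exp (- r) * exp p * exp q = exp (p + q - r)" for p q r :: real
    by (simp add: exp_add exp_diff exp_minus divide_inverse)
  ultimately show ?thesis unfolding quad gauss_density_def by metis
qed

section \<open>Measurability of the blocks\<close>

lemma finite_limits:
  fixes E :: "('n::finite) set set"
  assumes "stratified_graph E L"
  shows "finite (lower_limits E L C z)" "finite (upper_limits E L C z)"
proof -
  have fin: "finite (\<Union>e. L e)" using assms by (auto simp: stratified_graph_def)
  show "finite (lower_limits E L C z)"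
    by (rule finite_subset[OF _ finite_imageI[OF fin, of "\<lambda>B. real_of_ereal (fst (B z))"]])
       (force simp: lower_limits_def)
  show "finite (upper_limits E L C z)"
    by (rule finite_subset[OF _ finite_imageI[OF fin, of "\<lambda>B. real_of_ereal (snd (B z))"]])
       (force simp: upper_limits_def)
qed

text \<open>\<open>Inl a\<close> is the cut immediately after the lower limit \<open>a\<close>, \<open>Inr b\<close> the cut immediately before the
  upper limit \<open>b\<close>; the two must be kept apart when \<open>a = b\<close>.\<close>

definition cuts ::
  "('n::finite) set set \<Rightarrow> ('n set \<Rightarrow> 'n box set) \<Rightarrow> ('n set \<times> 'n \<times> (real + real)) set" where
  "cuts E L = (SIGMA C:UNIV. SIGMA z:UNIV. lower_limits E L C z <+> upper_limits E L C z)"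

definition cuts_above ::
  "('n::finite) set set \<Rightarrow> ('n set \<Rightarrow> 'n box set) \<Rightarrow> real^'n \<Rightarrow> ('n set \<times> 'n \<times> (real + real)) set" where
  "cuts_above E L x = {(C, z, w) \<in> cuts E L. case w of Inl a \<Rightarrow> x $ z \<le> a | Inr b \<Rightarrow> x $ z < b}"

lemma finite_cuts: "stratified_graph E L \<Longrightarrow> finite (cuts E L)"
  unfolding cuts_def by (intro finite_SigmaI finite_Plus finite_limits) auto

text \<open>Points on the same side of every cut have coordinates in the same intervals, hence the same parent
  outcomes, and a point enters the definition of the attached graph only through these.\<close>

lemma graph_at_cong:
  assumes "cuts_above E L x = cuts_above E L y"
  shows "graph_at E L x = graph_at E L y"
proof -
  have "same_interval E L C z `` {x $ z} = same_interval E L C z `` {y $ z}" for C z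
  proof -
    have "x $ z \<le> w \<longleftrightarrow> y $ z \<le> w" if "w \<in> lower_limits E L C z" for w
    proof -
      have "(C, z, Inl w) \<in> cuts_above E L x \<longleftrightarrow> (C, z, Inl w) \<in> cuts_above E L y"
        using assms by simp
      with that show ?thesis by (auto simp: cuts_above_def cuts_def)
    qed
    moreover have "x $ z < w \<longleftrightarrow> y $ z < w" if "w \<in> upper_limits E L C z" for w
    proof -
      have "(C, z, Inr w) \<in> cuts_above E L x \<longleftrightarrow> (C, z, Inr w) \<in> cuts_above E L y"
        using assms by simp
      with that show ?thesis by (auto simp: cuts_above_def cuts_def)
    qed
    ultimately show ?thesis by (simp add: same_interval_def set_eq_iff)
  qed
  then have "outcome_of E L C v x = outcome_of E L C v y" for C v
    by (simp add: outcome_of_def)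
  then show ?thesis by (simp add: graph_at_def deleted_edges_def)
qed

text \<open>A level set of \<open>cuts_above E L\<close> is a finite intersection of half-spaces and their complements; a
  block is the union of the finitely many such sets that it meets.\<close>

lemma borel_graph_at_level:
  assumes "stratified_graph E L"
  shows "{x. graph_at E L x = H} \<in> sets borel"
proof -
  have half: "{x. (C, z, w) \<in> cuts_above E L x} \<in> sets borel" for C z w
    by (cases "(C, z, w) \<in> cuts E L"; cases w) (auto simp: cuts_above_def)
  have level: "{x. cuts_above E L x = Q} \<in> sets borel" for Q
  proof (cases "Q \<subseteq> cuts E L")
    case True
    have sub: "cuts_above E L x \<subseteq> cuts E L" for x by (auto simp: cuts_above_def)
    have "{x. cuts_above E L x = Q} =
        (\<Inter>q\<in>cuts E L. {x. q \<in> cuts_above E L x \<longleftrightarrow> q \<in> Q})"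
    proof (rule set_eqI)
      fix x
      have "cuts_above E L x = Q \<longleftrightarrow> (\<forall>q\<in>cuts E L. q \<in> cuts_above E L x \<longleftrightarrow> q \<in> Q)"
        using True sub[of x] by blast
      then show "x \<in> {x. cuts_above E L x = Q} \<longleftrightarrow>
          x \<in> (\<Inter>q\<in>cuts E L. {x. q \<in> cuts_above E L x \<longleftrightarrow> q \<in> Q})"
        by simp
    qed
    also have "\<dots> \<in> sets borel"
    proof (cases "cuts E L = {}")
      case False
      have "{x. q \<in> cuts_above E L x \<longleftrightarrow> q \<in> Q} \<in> sets borel" for q
        using half[of "fst q" "fst (snd q)" "snd (snd q)"]
        by (cases "q \<in> Q") (auto simp: Collect_neg_eq intro: borel_comp)
      then show ?thesis
        using finite_cuts[OF assms] False by (intro sets.finite_INT) auto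
    qed simp
    finally show ?thesis .
  next
    case False
    then have "{x. cuts_above E L x = Q} = {}" by (auto simp: cuts_above_def)
    then show ?thesis by simp
  qed
  let ?Q = "cuts_above E L ` {x. graph_at E L x = H}"
  have "?Q \<subseteq> Pow (cuts E L)" by (auto simp: cuts_above_def)
  then have "finite ?Q" using finite_cuts[OF assms] by (meson finite_Pow_iff finite_subset)
  then have "(\<Union>Q\<in>?Q. {x. cuts_above E L x = Q}) \<in> sets borel"
    using level by (intro sets.finite_UN) auto
  also have "(\<Union>Q\<in>?Q. {x. cuts_above E L x = Q}) = {x. graph_at E L x = H}"
    by (auto dest: graph_at_cong)
  finally show ?thesis .
qed

section \<open>Density and exponential form\<close>

lemma sg_unnormalized_eq:
  "sg_unnormalized E L S x = gauss_density (matrix_inv (ipf S (graph_at E L x))) x"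
proof -
  have "sg_unnormalized E L S x = (\<Sum>H\<in>range (graph_at E L).
      if graph_at E L x = H then gauss_density (matrix_inv (ipf S H)) x else 0)"
    unfolding sg_unnormalized_def by (intro sum.cong) (auto simp: indicator_def)
  then show ?thesis by simp
qed

lemma sg_unnormalized_pos: "pos_def S \<Longrightarrow> 0 < sg_unnormalized E L S x"
  by (simp add: sg_unnormalized_eq gauss_density_pos pos_def_matrix_inv pos_def_ipf)

lemma integrable_sg_unnormalized:
  assumes "stratified_graph E L" "pos_def S"
  shows "integrable lborel (sg_unnormalized E L S)"
  unfolding sg_unnormalized_def
  using assms by (intro Bochner_Integration.integrable_sum integrable_real_mult_indicator
      integrable_gauss_density pos_def_matrix_inv pos_def_ipf) (auto simp: borel_graph_at_level)

lemma sg_Z_pos: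
  fixes S :: "real^'n^'n"
  assumes "stratified_graph E L" "pos_def S"
  shows "0 < sg_Z E L S"
proof -
  have pos: "0 < sg_unnormalized E L S x" for x by (rule sg_unnormalized_pos[OF assms(2)])
  have int: "integrable lborel (sg_unnormalized E L S)" by (rule integrable_sg_unnormalized[OF assms])
  have "0 \<le> sg_Z E L S" unfolding sg_Z_def by (simp add: pos less_imp_le)
  moreover have "sg_Z E L S \<noteq> 0"
  proof
    assume "sg_Z E L S = 0"
    then have "AE x in lborel. sg_unnormalized E L S x = 0"
      unfolding sg_Z_def using integral_nonneg_eq_0_iff_AE[OF int] pos by (simp add: less_imp_le)
    then have "AE x in (lborel :: (real^'n) measure). False"
      using pos by (auto elim!: eventually_mono simp: less_le)
    then show False by (simp add: ae_filter_eq_bot_iff eventually_False)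
  qed
  ultimately show ?thesis by simp
qed

lemma prob_density_sg_density:
  assumes "stratified_graph E L" "pos_def S"
  shows "prob_density (sg_density E L S)"
proof -
  have Z: "0 < sg_Z E L S" by (rule sg_Z_pos[OF assms])
  have "has_bochner_integral lborel (sg_unnormalized E L S) (sg_Z E L S)"
    unfolding sg_Z_def by (intro has_bochner_integral_integrable integrable_sg_unnormalized assms)
  then have "has_bochner_integral lborel (\<lambda>x. 1 / sg_Z E L S * sg_unnormalized E L S x)
      (1 / sg_Z E L S * sg_Z E L S)"
    by (rule has_bochner_integral_mult_right[rotated])
  moreover have "0 \<le> sg_density E L S x" for x
    using Z sg_unnormalized_pos[OF assms(2), of E L x] by (simp add: sg_density_def)
  ultimately show ?thesis using Z by (simp add: prob_density_def sg_density_def[abs_def])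
qed

theorem theorem2:
  fixes E :: "('n::finite) set set" and L :: "'n set \<Rightarrow> 'n box set"
  assumes "decomposable_SG E L"
  shows "curved_exponential_family (CARD('n) * (CARD('n) + 1) div 2)
           {S :: real^'n^'n. pos_def S} (sg_density E L)"
proof -
  have sg: "stratified_graph E L" using assms by (simp add: decomposable_SG_def)
  let ?G = "graph_at E L"
  define I where "I = range ?G \<times> (UNIV :: ('n \<times> 'n) option set)"
  define K where "K S H = matrix_inv (ipf S H)" for S :: "real^'n^'n" and H
  \<comment> \<open>Parameters \<open>c\<close> and statistics \<open>m\<close> are indexed by a block and either \<open>None\<close>, for the indicator of the
    block, or \<open>Some (a, b)\<close>, for the product of the coordinates \<open>a\<close> and \<open>b\<close> on the block.\<close>
  define c where "c S = (\<lambda>(H, t). case t of None \<Rightarrow> ln (sqrt (det (K S H)))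
      | Some (a, b) \<Rightarrow> - (1/2) * K S H $ a $ b)" for S
  define m where "m x = (\<lambda>(H, t). of_bool (?G x = H) *
      (case t of None \<Rightarrow> 1 | Some (a, b) \<Rightarrow> x $ a * x $ b))" for x :: "real^'n"
  define \<psi> where "\<psi> S = real CARD('n) / 2 * ln (2 * pi) + ln (sg_Z E L S)" for S
  obtain f where f: "bij_betw f {1..card I} I"
    using ex_bij_betw_nat_finite_1[of I] by (auto simp: I_def)

  have "CARD('n) * (CARD('n) + 1) div 2 \<le> CARD('n) * CARD('n)"
    by (rule order_trans[OF div_le_mono[of _ "2 * (CARD('n) * CARD('n))"]]) simp_all
  also have "\<dots> < CARD(('n \<times> 'n) option)" by (simp add: card_UNIV_option)
  also have "\<dots> \<le> card I"
    using mult_le_mono1[of 1 "card (range ?G)" "CARD(('n \<times> 'n) option)"]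
    by (simp add: I_def card_cartesian_product card_gt_0_iff Suc_le_eq)
  finally have k: "CARD('n) * (CARD('n) + 1) div 2 < card I" .

  have "sg_density E L S x = exp ((\<Sum>i=1..card I. c S (f i) * m x (f i)) - \<psi> S) * 1"
    if S: "pos_def S" for S x
  proof -
    let ?K = "K S (?G x)"
    have pd: "pos_def ?K" using S by (simp add: K_def pos_def_matrix_inv pos_def_ipf)
    have "(\<Sum>i=1..card I. c S (f i) * m x (f i)) = (\<Sum>j\<in>I. c S j * m x j)"
      by (rule sum.reindex_bij_betw[OF f])
    also have "\<dots> = (\<Sum>H\<in>range ?G. \<Sum>t\<in>UNIV. c S (H, t) * m x (H, t))"
      by (simp add: I_def sum.cartesian_product)
    also have "\<dots> = (\<Sum>H\<in>range ?G. if ?G x = H then \<Sum>t\<in>UNIV. c S (H, t) * m x (H, t) else 0)"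
      by (intro sum.cong) (auto simp: m_def)
    also have "\<dots> = (\<Sum>t\<in>UNIV. c S (?G x, t) * m x (?G x, t))" by simp
    also have "\<dots> = ln (sqrt (det ?K)) + (\<Sum>(a, b)\<in>UNIV. - (1/2) * ?K $ a $ b * (x $ a * x $ b))"
      by (simp add: UNIV_option_conv sum.reindex c_def m_def case_prod_unfold)
    finally have "exp ((\<Sum>i=1..card I. c S (f i) * m x (f i)) - \<psi> S)
        = gauss_density ?K x / sg_Z E L S"
      using sg_Z_pos[OF sg S] by (simp add: gauss_density_exp[OF pd] \<psi>_def exp_diff exp_add)
    then show ?thesis by (simp add: sg_density_def sg_unnormalized_eq K_def)
  qed
  then show ?thesis
    unfolding curved_exponential_family_def using k prob_density_sg_density[OF sg]
    by (intro conjI exI[of _ "card I"] exI[of _ "\<lambda>i S. c S (f i)"] exI[of _ \<psi>]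
        exI[of _ "\<lambda>i x. m x (f i)"] exI[of _ "\<lambda>_. 1"]) auto
qed

end
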